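(* Let $C$ be a spherical convex body in $S^n$ and let $0<\tau<\pi$. Then $C$ is of constant diameter $\tau$ if and only if $C$ is of constant width $\tau$.
   Context: $S^n$ is the unit sphere in $\mathbb{R}^{n+1}$, with origin $O$ and Euclidean inner product $\cdot$. The spherical distance of $P,Q\in S^n$ is $|PQ|=\arccos(\overrightarrow{OP}\cdot\overrightarrow{OQ})$. A set $K\subseteq S^n$ is spherically convex if the cone $\{\lambda u:\lambda>0,u\in K\}$ is convex in $\mathbb{R}^{n+1}$. A spherical convex body is a closed, spherically convex subset of $S^n$ with nonempty interior relative to $S^n$. The boundary of $K$ relative to $S^n$ is denoted $\partial K$. For $P\in S^n$, the closed hemisphere centered at $P$ is $S^+_P=\{Q\in S^n:\overrightarrow{OP}\cdot\overrightarrow{OQ}\ge 0\}$. If $K\subseteq S^+_Q$ and some boundary point $P\in\partial K$ lies on the boundary great sphere $\{R\in S^n:\overrightarrow{OQ}\cdot\overrightarrow{OR}=0\}$ of $S^+_Q$, then $S^+_Q$ is called a supporting hemisphere of $K$ at $P$. If $S^+_P\neq S^+_Q$ and the two hemispheres are not opposite, then $S^+_P\cap S^+_Q$ is called a lune, and its thickness is $\Delta(S^+_P\cap S^+_Q)=\pi-|PQ|$. For a supporting hemisphere $S^+_P$ of a spherical convex body $K$, the width of $K$ with respect to $S^+_P$ is $\mathrm{width}_{S^+_P}(K)=\min\{\Delta(S^+_P\cap S^+_Q): K\subset S^+_Q\}$. The body $K$ is of constant width $\tau$ if $\mathrm{width}_{S^+_P}(K)=\tau$ for every supporting hemisphere $S^+_P$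 of $K$. The diameter of $K$ is $\max\{|PQ|:P,Q\in K\}$. The body $K$ is of constant diameter $\tau$ if its diameter is $\tau$ and, for every $P\in\partial K$, there is $Q\in K$ with $|PQ|=\tau$. *)

theory Defs
  imports "HOL-Analysis.Analysis"
begin

definition usphere :: "'a::euclidean_space set" where
  "usphere = {x. norm x = 1}"

definition sdist :: "'a::euclidean_space \<Rightarrow> 'a \<Rightarrow> real" where
  "sdist P Q = arccos (P \<bullet> Q)"

definition sph_convex :: "'a::euclidean_space set \<Rightarrow> bool" where
  "sph_convex K \<longleftrightarrow> K \<subseteq> usphere \<and> convex {l *\<^sub>R u | l u. l > 0 \<and> u \<in> K}"

definition sph_interior :: "'a::euclidean_space set \<Rightarrow> 'a set" where
  "sph_interior K = {x \<in> K. \<exists>e>0. usphere \<inter> ball x e \<subseteq> K}"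

definition sph_boundary :: "'a::euclidean_space set \<Rightarrow> 'a set" where
  "sph_boundary K = {x \<in> usphere. \<forall>e>0. ball x e \<inter> K \<noteq> {} \<and> ball x e \<inter> (usphere - K) \<noteq> {}}"

definition sph_convex_body :: "'a::euclidean_space set \<Rightarrow> bool" where
  "sph_convex_body K \<longleftrightarrow> K \<subseteq> usphere \<and> closed K \<and> sph_convex K \<and> sph_interior K \<noteq> {}"

definition hemisphere :: "'a::euclidean_space \<Rightarrow> 'a set" where
  "hemisphere P = {Q \<in> usphere. P \<bullet> Q \<ge> 0}"

definition supporting_hemisphere_at :: "'a::euclidean_space set \<Rightarrow> 'a \<Rightarrow> 'a \<Rightarrow> bool" where
  "supporting_hemisphere_at K Q P \<longleftrightarrow> Q \<in> usphere \<and> K \<subseteq> hemisphere Q \<and>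
     P \<in> sph_boundary K \<and> P \<in> usphere \<and> Q \<bullet> P = 0"

definition supporting_hemisphere :: "'a::euclidean_space set \<Rightarrow> 'a \<Rightarrow> bool" where
  "supporting_hemisphere K Q \<longleftrightarrow> (\<exists>P. supporting_hemisphere_at K Q P)"

text \<open>Thickness of the lune S^+_P \<inter> S^+_Q (for P \<noteq> Q, P \<noteq> -Q).\<close>
definition lune_thickness :: "'a::euclidean_space \<Rightarrow> 'a \<Rightarrow> real" where
  "lune_thickness P Q = pi - sdist P Q"

definition lune_thicknesses :: "'a::euclidean_space set \<Rightarrow> 'a \<Rightarrow> real set" where
  "lune_thicknesses K P = {lune_thickness P Q | Q. Q \<in> usphere \<and>
      hemisphere P \<noteq> hemisphere Q \<and> hemisphere Q \<noteq> hemisphere (- P) \<and> K \<subseteq> hemisphere Q}"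

definition has_width :: "'a::euclidean_space set \<Rightarrow> 'a \<Rightarrow> real \<Rightarrow> bool" where
  "has_width K P w \<longleftrightarrow> w \<in> lune_thicknesses K P \<and> (\<forall>t \<in> lune_thicknesses K P. w \<le> t)"

definition constant_width :: "'a::euclidean_space set \<Rightarrow> real \<Rightarrow> bool" where
  "constant_width K \<tau> \<longleftrightarrow> (\<forall>P. supporting_hemisphere K P \<longrightarrow> has_width K P \<tau>)"

definition has_diameter :: "'a::euclidean_space set \<Rightarrow> real \<Rightarrow> bool" where
  "has_diameter K d \<longleftrightarrow> d \<in> {sdist P Q | P Q. P \<in> K \<and> Q \<in> K} \<and>
     (\<forall>P \<in> K. \<forall>Q \<in> K. sdist P Q \<le> d)"

definition constant_diameter :: "'a::euclidean_space set \<Rightarrow> real \<Rightarrow> bool" where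
  "constant_diameter K \<tau> \<longleftrightarrow> has_diameter K \<tau> \<and>
     (\<forall>P \<in> sph_boundary K. \<exists>Q \<in> K. sdist P Q = \<tau>)"

end

theory Submission
  imports Defs
begin

text \<open>
  Replace the body by the closed convex cone \<open>D\<close> that it spans. Supporting hemispheres are the unit
  vectors on the frontier of the dual cone, so constant width \<open>\<tau>\<close> of \<open>D\<close> means constant diameter
  \<open>\<pi> - \<tau>\<close> of the dual cone. By biduality it is enough to show that constant diameter \<open>\<tau>\<close> of \<open>D\<close>
  implies constant diameter \<open>\<pi> - \<tau>\<close> of the dual.

  The key fact is that for every boundary point \<open>x\<close> and every unit normal \<open>p\<close> at \<open>x\<close> the point
  \<open>y = x cos \<tau> + p sin \<tau>\<close> belongs to \<open>D\<close>. Since \<open>x\<close> and \<open>y\<close> realize the diameter, the vector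
  \<open>(x - y cos \<tau>) / sin \<tau>\<close> is a normal at \<open>y\<close>, and it has distance \<open>\<pi> - \<tau>\<close> from \<open>p\<close>. Conversely,
  if \<open>p\<close>, \<open>r\<close> realize the diameter \<open>\<delta>\<close> of the dual, then \<open>x = (p - r cos \<delta>) / sin \<delta>\<close> is in \<open>D\<close> and
  orthogonal to \<open>r\<close>, so \<open>x cos \<tau> + r sin \<tau>\<close> is in \<open>D\<close>; its inner product with \<open>p\<close> is
  \<open>sin (\<delta> + \<tau>)\<close>, which must be nonnegative.
\<close>

section \<open>Dual cones\<close>

definition dual_cone :: "'a::real_inner set \<Rightarrow> 'a set" where
  "dual_cone D = {p. \<forall>x\<in>D. 0 \<le> p \<bullet> x}"

lemma convex_cone_dual_cone: "convex_cone (dual_cone D)"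
  by (auto simp: convex_cone_iff dual_cone_def inner_add_left)

lemma closed_dual_cone: "closed (dual_cone D)"
proof -
  have "dual_cone D = (\<Inter>x\<in>D. {p. x \<bullet> p \<ge> 0})"
    by (auto simp: dual_cone_def inner_commute)
  then show ?thesis
    by (auto intro: closed_halfspace_ge)
qed

lemma dual_coneD: "p \<in> dual_cone D \<Longrightarrow> x \<in> D \<Longrightarrow> 0 \<le> p \<bullet> x"
  by (simp add: dual_cone_def)

text \<open>The separating threshold \<open>b\<close> is negative because \<open>0 \<in> D\<close>.
  A point of \<open>D\<close> with negative inner product could be rescaled onto the separating
  hyperplane, so \<open>a\<close> lies in the dual cone.\<close>

lemma convex_cone_separation:
  fixes D :: "'a::euclidean_space set"
  assumes "closed D" "convex_cone D" "p \<notin> D"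
  obtains v where "v \<in> dual_cone D" "v \<bullet> p < 0"
proof -
  obtain a b where ab: "a \<bullet> p < b" "\<And>x. x \<in> D \<Longrightarrow> b < a \<bullet> x"
    using separating_hyperplane_closed_point[of D p] assms convex_cone_def by metis
  have "b < 0"
    using ab(2)[of 0] convex_cone_contains_0[OF assms(2)] by simp
  have "0 \<le> a \<bullet> x" if x: "x \<in> D" for x
  proof (rule ccontr)
    assume neg: "\<not> 0 \<le> a \<bullet> x"
    then have "b / (a \<bullet> x) \<ge> 0"
      using \<open>b < 0\<close> by (simp add: divide_nonpos_neg)
    then have "(b / (a \<bullet> x)) *\<^sub>R x \<in> D"
      using assms(2) x convex_cone_scaleR by blast
    from ab(2)[OF this] show False
      using neg by simp
  qed
  then show thesis
    using that[of a] ab(1) \<open>b < 0\<close> by (auto simp: dual_cone_def)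
qed

text \<open>Bipolar theorem: a point outside \<open>D\<close> is excluded from the bidual by its
  separating functional.\<close>

lemma dual_cone_dual_cone:
  fixes D :: "'a::euclidean_space set"
  assumes "closed D" "convex_cone D"
  shows "dual_cone (dual_cone D) = D"
proof
  show "D \<subseteq> dual_cone (dual_cone D)"
    by (auto simp: dual_cone_def inner_commute)
  show "dual_cone (dual_cone D) \<subseteq> D"
  proof
    fix p assume p: "p \<in> dual_cone (dual_cone D)"
    show "p \<in> D"
    proof (rule ccontr)
      assume "p \<notin> D"
      then obtain v where "v \<in> dual_cone D" "v \<bullet> p < 0"
        using convex_cone_separation[OF assms] by blast
      then show False
        using p dual_coneD[of p "dual_cone D" v] by (simp add: inner_commute)
    qed
  qed
qed

text \<open>Moving \<open>x\<close> by \<open>e\<close> against \<open>p\<close> stays in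
  \<open>D\<close> and lowers the inner product by \<open>e * norm p\<close>, yet must leave it
  nonnegative.\<close>

lemma dual_cone_interior_pos:
  fixes D :: "'a::euclidean_space set"
  assumes "x \<in> interior D" "p \<in> dual_cone D" "p \<noteq> 0"
  shows "0 < p \<bullet> x"
proof -
  obtain e where e: "e > 0" "cball x e \<subseteq> D"
    using assms(1) mem_interior_cball by blast
  have "x - (e / norm p) *\<^sub>R p \<in> cball x e"
    using e assms(3) by (simp add: dist_norm)
  then have "0 \<le> p \<bullet> (x - (e / norm p) *\<^sub>R p)"
    using e assms(2) dual_coneD by blast
  also have "\<dots> = p \<bullet> x - e * norm p"
    using assms(3) by (simp add: inner_diff_right power2_norm_eq_inner[symmetric] power2_eq_square)
  finally show ?thesis
    using e(1) assms(3) by (smt (verit) mult_pos_pos norm_le_zero_iff)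
qed

lemma frontier_convex_cone_normal:
  fixes D :: "'a::euclidean_space set"
  assumes "closed D" "convex_cone D" "interior D \<noteq> {}"
  shows "x \<in> frontier D \<longleftrightarrow> x \<in> D \<and> (\<exists>p\<in>dual_cone D. p \<noteq> 0 \<and> p \<bullet> x = 0)"
proof
  assume "x \<in> frontier D"
  then have x: "x \<in> D" "x \<notin> interior D"
    using assms(1) by (auto simp: frontier_def)
  have cv: "convex D"
    using assms(2) by (simp add: convex_cone_def)
  obtain a b where ab: "a \<noteq> 0" "a \<bullet> x \<le> b" "\<forall>y\<in>interior D. b \<le> a \<bullet> y"
    using separating_hyperplane_sets[of "{x}" "interior D"] x assms(3) cv convex_interior by auto
  have "D \<subseteq> closure (interior D)"
    using convex_closure_interior[OF cv assms(3)] closure_subset by blast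
  also have "\<dots> \<subseteq> {y. a \<bullet> y \<ge> b}"
    using ab(3) by (intro closure_minimal closed_halfspace_ge) auto
  finally have D: "a \<bullet> x \<le> a \<bullet> y" if "y \<in> D" for y
    using ab(2) that by fastforce
  \<comment> \<open>Testing at \<open>0\<close> and at twice \<open>x\<close> shows that the
    supporting hyperplane passes through the origin.\<close>
  have "a \<bullet> x = 0"
    using D[of 0] D[of "2 *\<^sub>R x"] x(1) assms(2)
    by (auto simp: convex_cone_contains_0 convex_cone_scaleR)
  then show "x \<in> D \<and> (\<exists>p\<in>dual_cone D. p \<noteq> 0 \<and> p \<bullet> x = 0)"
    using x(1) D ab(1) by (auto simp: dual_cone_def)
next
  assume "x \<in> D \<and> (\<exists>p\<in>dual_cone D. p \<noteq> 0 \<and> p \<bullet> x = 0)"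
  then show "x \<in> frontier D"
    using dual_cone_interior_pos assms(1) by (fastforce simp: frontier_def)
qed

text \<open>Nonempty interior of the dual cone expresses that \<open>D\<close> contains no line. In
  this form the class is visibly closed under duality.\<close>

definition body_cone :: "'a::euclidean_space set \<Rightarrow> bool" where
  "body_cone D \<longleftrightarrow> closed D \<and> convex_cone D \<and> interior D \<noteq> {} \<and> interior (dual_cone D) \<noteq> {}"

lemma body_cone_dual: "body_cone D \<Longrightarrow> body_cone (dual_cone D)"
  by (simp add: body_cone_def closed_dual_cone convex_cone_dual_cone dual_cone_dual_cone)

lemma body_cone_unit_vector:
  assumes D: "body_cone (D :: 'a::euclidean_space set)"
  obtains x where "x \<in> D" "norm x = 1"
proof -
  obtain x where x: "x \<in> D" "x \<noteq> 0"
  proof -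
    have "interior D \<noteq> {}" using D by (simp add: body_cone_def)
    then have "\<not> D \<subseteq> {0}"
      using interior_mono[of D "{0}"] by auto
    then show thesis using that by blast
  qed
  then show thesis
    using that[of "x /\<^sub>R norm x"] D by (auto simp: body_cone_def convex_cone_scaleR)
qed

text \<open>The cone over a spherical body of constant diameter \<open>arccos c\<close>.\<close>
definition const_diam_cone :: "'a::euclidean_space set \<Rightarrow> real \<Rightarrow> bool" where
  "const_diam_cone D c \<longleftrightarrow>
     (\<forall>x\<in>D. \<forall>y\<in>D. c * norm x * norm y \<le> x \<bullet> y) \<and>
     (\<forall>x\<in>frontier D. norm x = 1 \<longrightarrow> (\<exists>y\<in>D. norm y = 1 \<and> x \<bullet> y = c))"

section \<open>First-order conditions at pairs of extremal distance\<close>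

lemma norm_add_approx:
  fixes y w :: "'a::real_inner"
  assumes "norm y = 1"
  shows "\<bar>norm (y + w) - 1 - y \<bullet> w\<bar> \<le> (norm w)\<^sup>2 / 2"
proof -
  have yy: "y \<bullet> y = 1"
    using assms by (simp add: dot_square_norm)
  have "y \<bullet> (y + w) \<le> norm y * norm (y + w)"
    by (rule norm_cauchy_schwarz)
  then have 1: "1 + y \<bullet> w \<le> norm (y + w)"
    using assms yy by (simp add: inner_add_right)
  \<comment> \<open>Cauchy-Schwarz gave the lower estimate; this square gives the upper one.\<close>
  have "0 \<le> (norm (y + w) - 1)\<^sup>2"
    by simp
  also have "\<dots> = (norm (y + w))\<^sup>2 - 2 * norm (y + w) + 1"
    by (simp add: power2_eq_square algebra_simps)
  also have "(norm (y + w))\<^sup>2 = 1 + 2 * (y \<bullet> w) + (norm w)\<^sup>2"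
    using yy by (simp add: power2_norm_eq_inner inner_add_left inner_add_right inner_commute)
  finally show ?thesis
    using 1 by (simp add: abs_le_iff)
qed

lemma nonneg_if_first_order_bound:
  fixes a K :: real
  assumes "\<And>t. 0 < t \<Longrightarrow> 0 \<le> t * a + K * t\<^sup>2"
  shows "0 \<le> a"
proof (rule tendsto_lowerbound)
  show "((\<lambda>t. a + K * t) \<longlongrightarrow> a) (at_right 0)"
    by (auto intro!: tendsto_eq_intros)
  show "eventually (\<lambda>t. 0 \<le> a + K * t) (at_right 0)"
    unfolding eventually_at_right_field
  proof (intro exI[of _ 1] conjI allI impI)
    fix t :: real assume t: "0 < t"
    have "0 \<le> t * (a + K * t)"
      using assms[OF t] by (simp add: algebra_simps power2_eq_square)
    then show "0 \<le> a + K * t"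
      using t by (simp add: zero_le_mult_iff)
  qed simp
qed simp

text \<open>On \<open>D\<close> the function \<open>x \<bullet> z - c * norm z\<close> of
  \<open>z\<close> is nonnegative and vanishes at \<open>y\<close>. Its derivative at
  \<open>y\<close> in direction \<open>z\<close> is \<open>(x - c *\<^sub>R y) \<bullet> z\<close>,
  which is therefore nonnegative.\<close>

lemma extremal_pair_normal:
  assumes D: "convex_cone D"
    and le: "\<And>z. z \<in> D \<Longrightarrow> c * norm z \<le> x \<bullet> z"
    and y: "y \<in> D" "norm y = 1" "x \<bullet> y = c"
  shows "x - c *\<^sub>R y \<in> dual_cone D"
  unfolding dual_cone_def
proof (intro CollectI ballI)
  fix z assume z: "z \<in> D"
  show "0 \<le> (x - c *\<^sub>R y) \<bullet> z"
  proof (rule nonneg_if_first_order_bound)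
    fix t :: real assume t: "0 < t"
    have "y + t *\<^sub>R z \<in> D"
      using D y z t by (simp add: convex_cone_add convex_cone_scaleR)
    from le[OF this] have 1: "c * (norm (y + t *\<^sub>R z) - 1) \<le> t * (x \<bullet> z)"
      using y by (simp add: inner_add_right algebra_simps)
    have "\<bar>c * (norm (y + t *\<^sub>R z) - 1 - t * (y \<bullet> z))\<bar> \<le> \<bar>c\<bar> * (t\<^sup>2 * (norm z)\<^sup>2 / 2)"
      using norm_add_approx[OF y(2), of "t *\<^sub>R z"] t
      unfolding abs_mult by (intro mult_left_mono) (simp_all add: power_mult_distrib)
    then have "- (\<bar>c\<bar> * (t\<^sup>2 * (norm z)\<^sup>2 / 2)) \<le> c * (norm (y + t *\<^sub>R z) - 1 - t * (y \<bullet> z))"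
      by linarith
    also have "\<dots> = c * (norm (y + t *\<^sub>R z) - 1) - t * (c * (y \<bullet> z))"
      by (simp add: algebra_simps)
    finally show "0 \<le> t * ((x - c *\<^sub>R y) \<bullet> z) + (\<bar>c\<bar> * (norm z)\<^sup>2 / 2) * t\<^sup>2"
      using 1 by (simp add: inner_diff_left algebra_simps)
  qed
qed

text \<open>Equality would yield a normal of \<open>D\<close> orthogonal to the interior point
  \<open>z\<close>, hence zero. Then \<open>y\<close> would be \<open>c\<close> times a unit vector,
  against \<open>\<bar>c\<bar> < 1\<close>.\<close>

lemma const_diam_cone_strict_interior:
  assumes D: "body_cone D" and cd: "const_diam_cone D c"
    and c: "-1 < c" "c < 1"
    and z: "z \<in> interior D" and y: "y \<in> D" "norm y = 1"
  shows "c * norm z < y \<bullet> z"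
proof (rule ccontr)
  assume "\<not> c * norm z < y \<bullet> z"
  have zD: "z \<in> D"
    using z interior_subset by blast
  then have yz: "y \<bullet> z = c * norm z"
    using cd y \<open>\<not> c * norm z < y \<bullet> z\<close> by (fastforce simp: const_diam_cone_def)
  have z0: "z \<noteq> 0"
  proof
    assume "z = 0"
    obtain p where "p \<in> dual_cone D" "norm p = 1"
      using body_cone_unit_vector[OF body_cone_dual[OF D]] .
    then show False
      using dual_cone_interior_pos[OF z, of p] \<open>z = 0\<close> by force
  qed
  let ?z = "z /\<^sub>R norm z"
  have "y - c *\<^sub>R ?z \<in> dual_cone D"
  proof (rule extremal_pair_normal)
    show "convex_cone D" using D by (simp add: body_cone_def)
    then show "?z \<in> D" using zD by (simp add: convex_cone_scaleR)
    show "norm ?z = 1" using z0 by simp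
    show "y \<bullet> ?z = c" using z0 yz by simp
    show "\<And>w. w \<in> D \<Longrightarrow> c * norm w \<le> y \<bullet> w"
      using cd y by (fastforce simp: const_diam_cone_def)
  qed
  moreover have "(y - c *\<^sub>R ?z) \<bullet> z = 0"
    using z0 yz by (simp add: inner_diff_left dot_square_norm power2_eq_square)
  ultimately have "y = c *\<^sub>R ?z"
    using dual_cone_interior_pos[OF z, of "y - c *\<^sub>R ?z"] by auto
  then have "norm y = \<bar>c\<bar> * norm ?z"
    using norm_scaleR by metis
  then show False
    using c y z0 by simp
qed

section \<open>Completeness of cones of constant diameter\<close>

lemma closed_segment_frontier:
  fixes a b :: "'a::euclidean_space"
  assumes "a \<in> S" "b \<notin> S"
  obtains k where "0 \<le> k" "k \<le> 1" "(1 - k) *\<^sub>R a + k *\<^sub>R b \<in> frontier S"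
proof -
  have "closed_segment a b \<inter> frontier S \<noteq> {}"
    by (rule connected_Int_frontier) (use assms in auto)
  then show thesis
    using that by (auto simp: in_segment)
qed

lemma const_diam_cone_partner:
  assumes D: "body_cone D" and cd: "const_diam_cone D c" and u: "u \<in> frontier D" "u \<noteq> 0"
  obtains y where "y \<in> D" "norm y = 1" "u \<bullet> y = c * norm u"
proof -
  have "u /\<^sub>R norm u \<in> frontier D"
    using u(1) D frontier_convex_cone_normal[of D]
    by (auto simp: body_cone_def convex_cone_scaleR)
  moreover have "norm (u /\<^sub>R norm u) = 1"
    using u(2) by simp
  ultimately obtain y where "y \<in> D" "norm y = 1" "(u /\<^sub>R norm u) \<bullet> y = c"
    using cd unfolding const_diam_cone_def by blast
  then show thesis
    using that[of y] u(2) by (simp add: field_simps)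
qed

text \<open>The restriction \<open>c \<ge> 0\<close> makes the balls of radius \<open>arccos c\<close> convex.\<close>
lemma const_diam_cone_complete:
  assumes D: "body_cone D" and cd: "const_diam_cone D c"
    and c: "0 \<le> c" "c < 1"
    and r: "\<And>z. z \<in> D \<Longrightarrow> c * norm z * norm r \<le> z \<bullet> r"
  shows "r \<in> D"
proof (rule ccontr)
  assume rD: "r \<notin> D"
  have cl: "closed D" and cone: "convex_cone D"
    using D by (auto simp: body_cone_def)
  obtain q where q: "q \<in> interior D"
    using D by (auto simp: body_cone_def)
  then have qD: "q \<in> D"
    using interior_subset by blast
  obtain k where k: "0 \<le> k" "k \<le> 1" and u: "(1 - k) *\<^sub>R q + k *\<^sub>R r \<in> frontier D"
    using closed_segment_frontier[OF qD rD] by blast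
  define u where "u = (1 - k) *\<^sub>R q + k *\<^sub>R r"
  have uD: "u \<in> D"
    using u cl by (simp add: u_def frontier_def)
  have "k < 1"
    using uD rD k by (cases "k = 1") (auto simp: u_def)
  \<comment> \<open>For \<open>c \<ge> 0\<close> the product \<open>q \<bullet> r\<close> is
    nonnegative, so \<open>u = 0\<close> forces \<open>q = 0\<close>; the origin would then be both
    an interior and a frontier point.\<close>
  have "u \<noteq> 0"
  proof
    assume "u = 0"
    have "0 < (1 - k) * (norm q)\<^sup>2" if "q \<noteq> 0"
      using \<open>k < 1\<close> that by simp
    moreover have "0 = q \<bullet> u" using \<open>u = 0\<close> by simp
    then have "0 = (1 - k) * (norm q)\<^sup>2 + k * (q \<bullet> r)"
      by (simp add: u_def inner_add_right power2_norm_eq_inner)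
    moreover have "0 \<le> k * (q \<bullet> r)"
      using r[OF qD] k c by (smt (verit) mult_nonneg_nonneg norm_ge_zero)
    ultimately have "q = 0" by fastforce
    then have "k *\<^sub>R r = 0"
      using \<open>u = 0\<close> by (simp add: u_def)
    then show False
      using rD cone convex_cone_contains_0 u q \<open>q = 0\<close> by (auto simp: frontier_def)
  qed
  then obtain y where y: "y \<in> D" "norm y = 1" "u \<bullet> y = c * norm u"
    using const_diam_cone_partner[OF D cd, of u] u by (auto simp: u_def)
  \<comment> \<open>The partner \<open>y\<close> of \<open>u\<close> satisfies the distance bound
    strictly against \<open>q\<close> and weakly against \<open>r\<close>. Convexity of the norm
    makes it strict against \<open>u\<close>, contradicting equality there.\<close>
  have "c * norm u \<le> c * ((1 - k) * norm q + k * norm r)"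
    unfolding u_def using k c norm_triangle_ineq[of "(1 - k) *\<^sub>R q" "k *\<^sub>R r"]
    by (intro mult_left_mono) auto
  also have "\<dots> = (1 - k) * (c * norm q) + k * (c * norm r)"
    by (simp add: algebra_simps)
  also have "\<dots> < (1 - k) * (y \<bullet> q) + k * (y \<bullet> r)"
    using const_diam_cone_strict_interior[OF D cd _ c(2) q y(1,2)] c r[OF y(1)] y(2) k \<open>k < 1\<close>
    by (intro add_less_le_mono mult_strict_left_mono mult_left_mono) auto
  also have "\<dots> = u \<bullet> y"
    by (simp add: u_def inner_commute[of q y] inner_commute[of r y] inner_add_left)
  finally show False
    using y by simp
qed

section \<open>Normal vectors of cones of constant diameter\<close>

text \<open>A nonzero \<open>a\<close> lies in this cone iff the point at distance \<open>arccos c\<close> from \<open>x\<close> in the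
  tangent direction \<open>a\<close>, scaled by \<open>norm a\<close>, lies in \<open>D\<close>. The scaling makes the condition
  homogeneous and closed.\<close>
definition contact_cone :: "'a::euclidean_space set \<Rightarrow> real \<Rightarrow> 'a \<Rightarrow> 'a set" where
  "contact_cone D c x =
     {a. a \<bullet> x = 0 \<and> (c * norm a) *\<^sub>R x + sqrt (1 - c\<^sup>2) *\<^sub>R a \<in> D}"

lemma norm_contact:
  assumes x: "norm x = 1" "a \<bullet> x = 0" and c: "\<bar>c\<bar> \<le> 1"
  shows "norm ((c * norm a) *\<^sub>R x + sqrt (1 - c\<^sup>2) *\<^sub>R a) = norm a"
proof -
  have "c\<^sup>2 \<le> 1"
    using c by (simp add: abs_square_le_1)
  then have "(norm ((c * norm a) *\<^sub>R x + sqrt (1 - c\<^sup>2) *\<^sub>R a))\<^sup>2 = (norm a)\<^sup>2"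
    using x by (subst norm_add_Pythagorean)
      (auto simp: orthogonal_def inner_commute power_mult_distrib algebra_simps)
  then show ?thesis
    by simp
qed

lemma closed_contact_cone: "closed D \<Longrightarrow> closed (contact_cone D c x)"
proof -
  assume D: "closed D"
  have "contact_cone D c x = {a. a \<bullet> x = 0} \<inter>
      (\<lambda>a. (c * norm a) *\<^sub>R x + sqrt (1 - c\<^sup>2) *\<^sub>R a) -` D"
    by (auto simp: contact_cone_def)
  then show ?thesis
    using D by (auto intro!: closed_Int closed_Collect_eq closed_vimage continuous_intros)
qed

text \<open>For \<open>c \<ge> 0\<close> additivity follows from completeness of bodies of constant diameter. For \<open>c < 0\<close>,
  the sum of two different points at maximal distance from \<open>x\<close> would be even farther from \<open>x\<close>,
  so the cone is at most a ray.\<close>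
lemma convex_cone_contact_cone:
  assumes D: "body_cone D" and cd: "const_diam_cone D c" and c: "-1 < c" "c < 1"
    and x: "x \<in> D" "norm x = 1"
  shows "convex_cone (contact_cone D c x)"
  unfolding convex_cone_iff
proof (intro conjI ballI allI impI)
  have cone: "convex_cone D"
    using D by (auto simp: body_cone_def)
  define f where "f a = (c * norm a) *\<^sub>R x + sqrt (1 - c\<^sup>2) *\<^sub>R a" for a
  have A: "a \<in> contact_cone D c x \<longleftrightarrow> a \<bullet> x = 0 \<and> f a \<in> D" for a
    by (simp add: contact_cone_def f_def)
  show "0 \<in> contact_cone D c x"
    using cone convex_cone_contains_0 by (simp add: contact_cone_def)
  show "l *\<^sub>R a \<in> contact_cone D c x" if "a \<in> contact_cone D c x" "0 \<le> l" for a l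
  proof -
    have "f (l *\<^sub>R a) = l *\<^sub>R f a"
      using that by (simp add: f_def algebra_simps)
    then show ?thesis
      using that A cone by (simp add: convex_cone_scaleR)
  qed
  fix a b assume a: "a \<in> contact_cone D c x" and b: "b \<in> contact_cone D c x"
  have nf: "norm (f w) = norm w" if "w \<bullet> x = 0" for w
    unfolding f_def using that x c by (intro norm_contact) auto
  have ab: "(a + b) \<bullet> x = 0"
    using a b A by (simp add: inner_add_left)
  have fab: "f (a + b) = f a + f b - (c * (norm a + norm b - norm (a + b))) *\<^sub>R x"
    by (simp add: f_def algebra_simps)
  have "f (a + b) \<in> D"
  proof (cases "0 \<le> c")
    case True
    show ?thesis
    proof (rule const_diam_cone_complete[OF D cd True c(2)])
      fix z assume z: "z \<in> D"
      \<comment> \<open>The map \<open>f\<close> fails to be additive by \<open>c * k\<close> times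
        \<open>x\<close>. This costs at most \<open>c * k * norm z\<close>, exactly the amount by
        which \<open>norm (a + b)\<close> lowers the required bound.\<close>
      define k where "k = norm a + norm b - norm (a + b)"
      have "k \<ge> 0"
        by (simp add: k_def norm_triangle_ineq)
      have "c * norm z * norm a \<le> z \<bullet> f a" "c * norm z * norm b \<le> z \<bullet> f b"
        using cd z a b A nf unfolding const_diam_cone_def by metis+
      moreover have "z \<bullet> x \<le> norm z"
        using norm_cauchy_schwarz[of z x] x by simp
      then have "c * k * (z \<bullet> x) \<le> c * k * norm z"
        using True \<open>k \<ge> 0\<close> by (intro mult_left_mono) auto
      moreover have "z \<bullet> f (a + b) = z \<bullet> f a + z \<bullet> f b - c * k * (z \<bullet> x)"
        by (simp add: fab inner_add_right inner_diff_right k_def)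
      ultimately show "c * norm z * norm (f (a + b)) \<le> z \<bullet> f (a + b)"
        unfolding nf[OF ab] k_def by (simp add: algebra_simps)
    qed
  next
    case False
    have fD: "f a + f b \<in> D"
      using a b A cone by (simp add: convex_cone_add)
    have xx: "x \<bullet> x = 1"
      using x by (simp add: dot_square_norm)
    have xf: "x \<bullet> f w = c * norm w" if "w \<bullet> x = 0" for w
      using that xx by (simp add: f_def inner_add_right inner_commute)
    \<comment> \<open>Division by the negative \<open>c\<close> reverses the triangle inequality.
      Equality makes \<open>f a\<close> and \<open>f b\<close> positively parallel, hence also
      \<open>a\<close> and \<open>b\<close>, and the correction term in \<open>fab\<close>
      vanishes.\<close>
    have "c * norm (f a + f b) \<le> x \<bullet> (f a + f b)"
      using cd x fD by (fastforce simp: const_diam_cone_def)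
    also have "\<dots> = c * (norm a + norm b)"
      using a b A xf by (simp add: inner_add_right algebra_simps)
    finally have "norm a + norm b \<le> norm (f a + f b)"
      using False by simp
    then have "norm (f a + f b) = norm (f a) + norm (f b)"
      using norm_triangle_ineq[of "f a" "f b"] nf a b A by simp
    then have "norm a *\<^sub>R f b = norm b *\<^sub>R f a"
      using norm_triangle_eq nf a b A by metis
    then have "sqrt (1 - c\<^sup>2) *\<^sub>R (norm a *\<^sub>R b) = sqrt (1 - c\<^sup>2) *\<^sub>R (norm b *\<^sub>R a)"
      by (simp add: f_def algebra_simps)
    moreover have "sqrt (1 - c\<^sup>2) \<noteq> 0"
      using c abs_square_less_1[of c] by auto
    ultimately have "norm (a + b) = norm a + norm b"
      unfolding norm_triangle_eq by (metis scaleR_cancel_left)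
    then show ?thesis
      using fab fD by simp
  qed
  then show "a + b \<in> contact_cone D c x"
    using A ab by simp
qed

text \<open>The tangential part of \<open>y\<close> at \<open>x\<close> has norm
  \<open>sqrt (1 - c\<^sup>2)\<close>, so its scaled contact point is a multiple of
  \<open>y\<close>.\<close>

lemma contact_coneI:
  assumes "norm x = 1" "norm y = 1" "x \<bullet> y = c" "y \<in> D" "\<bar>c\<bar> \<le> 1" "convex_cone D"
  shows "y - c *\<^sub>R x \<in> contact_cone D c x"
proof -
  have xx: "x \<bullet> x = 1" "y \<bullet> y = 1"
    using assms by (simp_all add: dot_square_norm)
  have c2: "c\<^sup>2 \<le> 1"
    using assms by (simp add: abs_square_le_1)
  have "(norm (y - c *\<^sub>R x))\<^sup>2 = 1 - c\<^sup>2"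
    unfolding power2_norm_eq_inner using xx assms(3)
    by (simp add: inner_diff_left inner_diff_right inner_commute power2_eq_square)
  then have n: "norm (y - c *\<^sub>R x) = sqrt (1 - c\<^sup>2)"
    using c2 by (metis norm_ge_zero real_sqrt_unique)
  have "(c * sqrt (1 - c\<^sup>2)) *\<^sub>R x + sqrt (1 - c\<^sup>2) *\<^sub>R (y - c *\<^sub>R x) = sqrt (1 - c\<^sup>2) *\<^sub>R y"
    by (simp add: algebra_simps)
  moreover have "\<dots> \<in> D"
    using assms c2 by (simp add: convex_cone_scaleR)
  moreover have "(y - c *\<^sub>R x) \<bullet> x = 0"
    using xx assms(3) by (simp add: inner_diff_left inner_commute[of y x])
  ultimately show ?thesis
    using n by (simp add: contact_cone_def)
qed

text \<open>If a normal \<open>p\<close> at \<open>x\<close> is not in the contact cone, separate it by \<open>v\<close>. Frontier points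
  \<open>x + h (q + r v)\<close> with \<open>h\<close> tending to \<open>0\<close>, \<open>q\<close> interior and \<open>r\<close> bounded have partners that
  accumulate at a partner \<open>y\<close> of \<open>x\<close>; to first order in \<open>h\<close> this forces
  \<open>(q + r v) \<bullet> (y - c x) \<le> 0\<close>, although \<open>y - c x\<close> is in the contact cone and in the dual cone.\<close>
lemma dual_cone_subset_contact_cone:
  assumes D: "body_cone D" and cd: "const_diam_cone D c" and c: "-1 < c" "c < 1"
    and x: "x \<in> D" "norm x = 1"
    and p: "p \<in> dual_cone D" "p \<noteq> 0" "p \<bullet> x = 0"
  shows "p \<in> contact_cone D c x"
proof (rule ccontr)
  assume "p \<notin> contact_cone D c x"
  have cl: "closed D" and cone: "convex_cone D"
    using D by (auto simp: body_cone_def)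
  obtain v where v: "v \<in> dual_cone (contact_cone D c x)" "v \<bullet> p < 0"
    using convex_cone_separation[OF closed_contact_cone[OF cl]
        convex_cone_contact_cone[OF D cd c x] \<open>p \<notin> _\<close>] by blast
  obtain q where q: "q \<in> interior D"
    using D by (auto simp: body_cone_def)
  then have qD: "q \<in> D"
    using interior_subset by blast
  \<comment> \<open>With this choice
    \<open>p \<bullet> (q + R *\<^sub>R v) = v \<bullet> p < 0\<close>: direction
    \<open>q + R *\<^sub>R v\<close> leaves \<open>D\<close> at \<open>x\<close>, while
    \<open>q\<close> stays inside.\<close>
  define R where "R = (p \<bullet> q) / (- (v \<bullet> p)) + 1"
  have pq: "0 < p \<bullet> q"
    using dual_cone_interior_pos[OF q p(1,2)] .
  have "R \<ge> 1"
    using pq v by (simp add: R_def divide_nonneg_neg)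
  \<comment> \<open>\<open>M\<close> bounds all directions \<open>q + r *\<^sub>R v\<close> with
    \<open>0 \<le> r \<le> R\<close>. Steps \<open>h n\<close> with \<open>h n * M < 1\<close>
    cannot carry the unit vector \<open>x\<close> to the origin.\<close>
  define M where "M = norm q + R * norm v"
  have "M \<ge> 0"
    using \<open>R \<ge> 1\<close> by (simp add: M_def)
  define h where "h n = inverse (M + 1) * inverse (real (Suc n))" for n
  have h: "h n > 0" "h n * M < 1" for n
  proof -
    show "h n > 0"
      using \<open>M \<ge> 0\<close> by (simp add: h_def)
    have "h n * M = (M / (M + 1)) * (1 / real (Suc n))"
      by (simp add: h_def field_simps)
    also have "\<dots> \<le> M / (M + 1)"
      using \<open>M \<ge> 0\<close> by (intro mult_right_le_one_le) auto
    also have "\<dots> < 1"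
      using \<open>M \<ge> 0\<close> by simp
    finally show "h n * M < 1" .
  qed
  have "h \<longlonglongrightarrow> inverse (M + 1) * 0"
    unfolding h_def by (intro tendsto_mult tendsto_const LIMSEQ_inverse_real_of_nat)
  then have h0: "h \<longlonglongrightarrow> 0" by simp
  have "\<exists>r y. 0 \<le> r \<and> r \<le> R \<and> y \<in> D \<and> norm y = 1 \<and>
      (x + h n *\<^sub>R (q + r *\<^sub>R v)) \<bullet> y = c * norm (x + h n *\<^sub>R (q + r *\<^sub>R v))" for n
  proof -
    have 1: "x + h n *\<^sub>R q \<in> D"
      using x qD cone h[of n] by (simp add: convex_cone_add convex_cone_scaleR)
    have "p \<bullet> (x + h n *\<^sub>R (q + R *\<^sub>R v)) = h n * (p \<bullet> q + R * (v \<bullet> p))"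
      by (simp add: p(3) inner_add_right inner_commute)
    also have "p \<bullet> q + R * (v \<bullet> p) = v \<bullet> p"
      using v by (simp add: R_def field_simps)
    also have "h n * (v \<bullet> p) < 0"
      using h v by (simp add: mult_pos_neg)
    finally have 2: "x + h n *\<^sub>R (q + R *\<^sub>R v) \<notin> D"
      using dual_coneD[OF p(1)] by fastforce
    obtain k where k: "0 \<le> k" "k \<le> 1"
      "(1 - k) *\<^sub>R (x + h n *\<^sub>R q) + k *\<^sub>R (x + h n *\<^sub>R (q + R *\<^sub>R v)) \<in> frontier D"
      using closed_segment_frontier[OF 1 2] by blast
    define r where "r = k * R"
    have r: "0 \<le> r" "r \<le> R"
      using k \<open>R \<ge> 1\<close> by (auto simp: r_def mult_left_le_one_le)
    define u where "u = x + h n *\<^sub>R (q + r *\<^sub>R v)"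
    have "u \<in> frontier D"
      using k(3) by (simp add: u_def r_def algebra_simps)
    moreover have "u \<noteq> 0"
    proof
      assume "u = 0"
      then have "x = - (h n *\<^sub>R (q + r *\<^sub>R v))"
        by (simp add: u_def eq_neg_iff_add_eq_0)
      then have "1 = h n * norm (q + r *\<^sub>R v)"
        using x h[of n] by (metis abs_of_pos norm_minus_cancel norm_scaleR)
      also have "norm (q + r *\<^sub>R v) \<le> M"
        using r norm_triangle_ineq[of q "r *\<^sub>R v"] mult_right_mono[of r R "norm v"]
        by (simp add: M_def)
      finally show False
        using h[of n] by (simp add: mult_left_mono)
    qed
    ultimately obtain y where "y \<in> D" "norm y = 1" "u \<bullet> y = c * norm u"
      using const_diam_cone_partner[OF D cd] by blast
    then show ?thesis
      using r unfolding u_def by blast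
  qed
  then obtain r y where r: "\<And>n. 0 \<le> r n" "\<And>n. r n \<le> R"
    and y: "\<And>n. y n \<in> D" "\<And>n. norm (y n) = 1"
    and eq: "\<And>n. (x + h n *\<^sub>R (q + r n *\<^sub>R v)) \<bullet> y n = c * norm (x + h n *\<^sub>R (q + r n *\<^sub>R v))"
    by metis
  have "compact ({0..R} \<times> (D \<inter> sphere 0 1))"
    using cl by (intro compact_Times) (auto intro: closed_Int_compact)
  moreover have "\<forall>n. (r n, y n) \<in> {0..R} \<times> (D \<inter> sphere 0 1)"
    using r y by simp
  ultimately obtain l \<phi> where l: "l \<in> {0..R} \<times> (D \<inter> sphere 0 1)"
      and \<phi>: "strict_mono (\<phi> :: nat \<Rightarrow> nat)" "((\<lambda>n. (r n, y n)) \<circ> \<phi>) \<longlonglongrightarrow> l"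
    unfolding compact_def by meson
  obtain r' y' where l': "l = (r', y')" by (cases l)
  have lim: "(\<lambda>n. r (\<phi> n)) \<longlonglongrightarrow> r'" "(\<lambda>n. y (\<phi> n)) \<longlonglongrightarrow> y'"
    using tendsto_fst[OF \<phi>(2)] tendsto_snd[OF \<phi>(2)] by (simp_all add: l' o_def)
  have hlim: "(\<lambda>n. h (\<phi> n)) \<longlonglongrightarrow> 0"
    using LIMSEQ_subseq_LIMSEQ[OF h0 \<phi>(1)] by (simp add: o_def)
  have y': "y' \<in> D" "norm y' = 1" and r': "0 \<le> r'"
    using l by (auto simp: l')
  have xy: "x \<bullet> y' = c"
  proof (rule LIMSEQ_unique)
    show "(\<lambda>n. (x + h (\<phi> n) *\<^sub>R (q + r (\<phi> n) *\<^sub>R v)) \<bullet> y (\<phi> n)) \<longlonglongrightarrow> x \<bullet> y'"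
      by (auto intro!: tendsto_eq_intros lim hlim)
    show "(\<lambda>n. (x + h (\<phi> n) *\<^sub>R (q + r (\<phi> n) *\<^sub>R v)) \<bullet> y (\<phi> n)) \<longlonglongrightarrow> c"
      unfolding eq by (auto intro!: tendsto_eq_intros lim hlim simp: x(2))
  qed
  \<comment> \<open>Subtract \<open>c \<le> x \<bullet> y n\<close> from the partner equation,
    expand the norm at \<open>x\<close> with quadratic error, and divide by
    \<open>h n\<close>.\<close>
  have bound: "(q + r n *\<^sub>R v) \<bullet> (y n - c *\<^sub>R x) \<le> h n * (\<bar>c\<bar> * (norm (q + r n *\<^sub>R v))\<^sup>2 / 2)" for n
  proof -
    define w where "w = q + r n *\<^sub>R v"
    have "c \<le> x \<bullet> y n"
      using cd x y[of n] by (fastforce simp: const_diam_cone_def)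
    then have "h n * (w \<bullet> y n) \<le> c * (norm (x + h n *\<^sub>R w) - 1)"
      using eq[of n] by (simp add: w_def[symmetric] inner_add_left algebra_simps)
    also have "c * (norm (x + h n *\<^sub>R w) - 1) - h n * (c * (x \<bullet> w))
        = c * (norm (x + h n *\<^sub>R w) - 1 - x \<bullet> (h n *\<^sub>R w))"
      by (simp add: algebra_simps)
    then have "c * (norm (x + h n *\<^sub>R w) - 1) \<le> h n * (c * (x \<bullet> w))
        + \<bar>c * (norm (x + h n *\<^sub>R w) - 1 - x \<bullet> (h n *\<^sub>R w))\<bar>"
      by linarith
    also have "\<bar>c * (norm (x + h n *\<^sub>R w) - 1 - x \<bullet> (h n *\<^sub>R w))\<bar>
        \<le> \<bar>c\<bar> * ((norm (h n *\<^sub>R w))\<^sup>2 / 2)"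
      unfolding abs_mult[of c] by (intro mult_left_mono norm_add_approx x abs_ge_zero)
    also have "\<dots> = h n * (h n * (\<bar>c\<bar> * (norm w)\<^sup>2 / 2))"
      by (simp add: power2_eq_square)
    finally have "h n * (w \<bullet> (y n - c *\<^sub>R x)) \<le> h n * (h n * (\<bar>c\<bar> * (norm w)\<^sup>2 / 2))"
      by (simp add: inner_diff_right inner_commute algebra_simps)
    then show ?thesis
      using h(1)[of n] by (simp add: w_def)
  qed
  have le0: "(q + r' *\<^sub>R v) \<bullet> (y' - c *\<^sub>R x) \<le> 0"
  proof (rule LIMSEQ_le)
    show "(\<lambda>n. (q + r (\<phi> n) *\<^sub>R v) \<bullet> (y (\<phi> n) - c *\<^sub>R x)) \<longlonglongrightarrow> (q + r' *\<^sub>R v) \<bullet> (y' - c *\<^sub>R x)"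
      by (intro tendsto_intros lim)
    show "(\<lambda>n. h (\<phi> n) * (\<bar>c\<bar> * (norm (q + r (\<phi> n) *\<^sub>R v))\<^sup>2 / 2)) \<longlonglongrightarrow> 0"
      by (auto intro!: tendsto_eq_intros lim hlim)
    show "\<exists>N. \<forall>n\<ge>N. (q + r (\<phi> n) *\<^sub>R v) \<bullet> (y (\<phi> n) - c *\<^sub>R x)
        \<le> h (\<phi> n) * (\<bar>c\<bar> * (norm (q + r (\<phi> n) *\<^sub>R v))\<^sup>2 / 2)"
      using bound by blast
  qed
  have "y' - c *\<^sub>R x \<in> contact_cone D c x"
    using c by (intro contact_coneI x y' xy cone) auto
  then have "0 \<le> v \<bullet> (y' - c *\<^sub>R x)"
    using v(1) dual_coneD by blast
  then have "0 \<le> r' * (v \<bullet> (y' - c *\<^sub>R x))"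
    using r' by simp
  moreover have "0 < q \<bullet> (y' - c *\<^sub>R x)"
  proof -
    have "y' - c *\<^sub>R x \<in> dual_cone D"
    proof (rule extremal_pair_normal[OF cone _ x])
      show "\<And>z. z \<in> D \<Longrightarrow> c * norm z \<le> y' \<bullet> z"
        using cd y' by (fastforce simp: const_diam_cone_def)
      show "y' \<bullet> x = c"
        using xy by (simp add: inner_commute)
    qed
    moreover have "y' - c *\<^sub>R x \<noteq> 0"
    proof
      assume "y' - c *\<^sub>R x = 0"
      then have "norm y' = \<bar>c\<bar> * norm x"
        by (metis eq_iff_diff_eq_0 norm_scaleR)
      then show False
        using y' x c by simp
    qed
    ultimately show ?thesis
      using dual_cone_interior_pos[OF q] by (simp add: inner_commute[of q "y' - c *\<^sub>R x"])
  qed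
  ultimately show False
    using le0 by (simp add: inner_add_left)
qed

section \<open>Duality\<close>

lemma const_diam_cone_normal_point:
  assumes "body_cone D" "const_diam_cone D c" "-1 < c" "c < 1" "x \<in> D" "norm x = 1"
    "p \<in> dual_cone D" "norm p = 1" "p \<bullet> x = 0"
  shows "c *\<^sub>R x + sqrt (1 - c\<^sup>2) *\<^sub>R p \<in> D"
proof -
  have "p \<noteq> 0" using assms by auto
  then have "p \<in> contact_cone D c x"
    using dual_cone_subset_contact_cone[of D c x p] assms by blast
  then show ?thesis
    using assms by (simp add: contact_cone_def)
qed

text \<open>The pair \<open>x\<close>, \<open>y\<close> is extremal, so
  \<open>x - c *\<^sub>R y\<close> is a normal at \<open>y\<close>; its length is \<open>s\<close>.
  As \<open>p \<bullet> x = 0\<close> and \<open>p \<bullet> y = s\<close>, the normalized vector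
  has inner product \<open>- c\<close> with \<open>p\<close>.\<close>

lemma dual_const_diam_partner:
  assumes D: "body_cone D" and cd: "const_diam_cone D c" and c: "-1 < c" "c < 1"
    and p: "p \<in> frontier (dual_cone D)" "norm p = 1"
  obtains r where "r \<in> dual_cone D" "norm r = 1" "p \<bullet> r = - c"
proof -
  have cone: "convex_cone D"
    using D by (simp add: body_cone_def)
  have dd: "dual_cone (dual_cone D) = D"
    using D by (simp add: body_cone_def dual_cone_dual_cone)
  \<comment> \<open>By biduality, a normal of the dual cone at \<open>p\<close> is a vector of
    \<open>D\<close> orthogonal to \<open>p\<close>.\<close>
  have "p \<in> dual_cone D \<and> (\<exists>x\<in>D. x \<noteq> 0 \<and> x \<bullet> p = 0)"
    using frontier_convex_cone_normal[of "dual_cone D" p] body_cone_dual[OF D] p dd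
    by (simp add: body_cone_def)
  then obtain x0 where pD: "p \<in> dual_cone D" and x0: "x0 \<in> D" "x0 \<noteq> 0" "x0 \<bullet> p = 0"
    by blast
  define x where "x = x0 /\<^sub>R norm x0"
  have x: "x \<in> D" "norm x = 1" "p \<bullet> x = 0"
    using x0 cone by (simp_all add: x_def convex_cone_scaleR inner_commute)
  define s where "s = sqrt (1 - c\<^sup>2)"
  have s: "s > 0" "s * s = 1 - c\<^sup>2"
    using c abs_square_less_1[of c] by (auto simp: s_def)
  define y where "y = c *\<^sub>R x + s *\<^sub>R p"
  have y: "y \<in> D"
    unfolding y_def s_def using const_diam_cone_normal_point[OF D cd c] x pD p by blast
  have xx: "x \<bullet> x = 1" "p \<bullet> p = 1"
    using x p by (simp_all add: dot_square_norm)
  have "y \<bullet> y = 1"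
    using x xx s by (simp add: y_def inner_add_left inner_add_right inner_commute power2_eq_square)
  then have ny: "norm y = 1"
    by (simp add: norm_eq_1)
  have xy: "x \<bullet> y = c"
    using x xx by (simp add: y_def inner_add_right inner_commute)
  have py: "p \<bullet> y = s"
    using x xx by (simp add: y_def inner_add_right)
  have "x - c *\<^sub>R y \<in> dual_cone D"
    using cd x by (intro extremal_pair_normal[OF cone _ y ny xy]) (fastforce simp: const_diam_cone_def)
  then have "(x - c *\<^sub>R y) /\<^sub>R s \<in> dual_cone D"
    using s convex_cone_scaleR[OF convex_cone_dual_cone, of "inverse s"] by simp
  moreover have "norm ((x - c *\<^sub>R y) /\<^sub>R s) = 1"
  proof -
    have "((x - c *\<^sub>R y) /\<^sub>R s) \<bullet> ((x - c *\<^sub>R y) /\<^sub>R s) = (1 - c\<^sup>2) / (s * s)"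
      using xx \<open>y \<bullet> y = 1\<close> xy s(1)
      by (simp add: inner_diff_left inner_diff_right inner_commute power2_eq_square field_simps)
    also have "\<dots> = 1"
      unfolding s(2)[symmetric] using s(1) by simp
    finally show ?thesis
      unfolding norm_eq_1 .
  qed
  moreover have "p \<bullet> ((x - c *\<^sub>R y) /\<^sub>R s) = - c"
    using s x py by (simp add: inner_diff_right)
  ultimately show thesis
    using that by blast
qed

lemma cone_unit_inner_bound:
  fixes D :: "'a::euclidean_space set"
  assumes cone: "convex_cone D" and le: "\<And>p r. p \<in> D \<Longrightarrow> r \<in> D \<Longrightarrow> norm p = 1 \<Longrightarrow> norm r = 1 \<Longrightarrow> c \<le> p \<bullet> r"
    and "p \<in> D" "r \<in> D"
  shows "c * norm p * norm r \<le> p \<bullet> r"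
proof (cases "p = 0 \<or> r = 0")
  case False
  then have "c \<le> (p /\<^sub>R norm p) \<bullet> (r /\<^sub>R norm r)"
    using assms by (intro le) (auto simp: convex_cone_scaleR)
  then show ?thesis
    using False by (simp add: field_simps)
qed auto

text \<open>A pair of unit vectors realizing the diameter of a cone determines a normal vector at
  each of its members, so it suffices to bound inner products with frontier vectors.\<close>
lemma body_cone_inner_bound:
  fixes D :: "'a::euclidean_space set"
  assumes D: "body_cone D"
    and le: "\<And>p x r. \<lbrakk>p \<in> D; r \<in> D; x \<in> dual_cone D; norm p = 1; norm r = 1; norm x = 1;
       x \<bullet> r = 0; r \<in> frontier D; -1 < p \<bullet> r; p \<bullet> r < 1;
       p = (p \<bullet> r) *\<^sub>R r + sqrt (1 - (p \<bullet> r)\<^sup>2) *\<^sub>R x\<rbrakk> \<Longrightarrow> c \<le> p \<bullet> r"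
    and c: "c \<le> 1" and z: "z1 \<in> D" "z2 \<in> D"
  shows "c * norm z1 * norm z2 \<le> z1 \<bullet> z2"
proof (rule cone_unit_inner_bound)
  show cone: "convex_cone D"
    using D by (simp add: body_cone_def)
  fix z1 z2 assume z: "z1 \<in> D" "z2 \<in> D" "norm z1 = 1" "norm z2 = 1"
  \<comment> \<open>By compactness some pair of unit vectors has least inner product
    \<open>d\<close>; it suffices to bound \<open>d\<close>.\<close>
  define S where "S = (D \<inter> sphere 0 1) \<times> (D \<inter> sphere 0 1)"
  have "compact S" "S \<noteq> {}"
    using D z unfolding S_def by (auto intro!: compact_Times closed_Int_compact simp: body_cone_def)
  moreover have "continuous_on S (\<lambda>w. fst w \<bullet> snd w)"
    by (intro continuous_intros)
  ultimately have "\<exists>w\<in>S. \<forall>w'\<in>S. fst w \<bullet> snd w \<le> fst w' \<bullet> snd w'"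
    by (rule continuous_attains_inf)
  then obtain w where "w \<in> S" and w: "\<And>w'. w' \<in> S \<Longrightarrow> fst w \<bullet> snd w \<le> fst w' \<bullet> snd w'"
    by blast
  define p r where "p = fst w" and "r = snd w"
  have pr: "p \<in> D" "norm p = 1" "r \<in> D" "norm r = 1"
    using \<open>w \<in> S\<close> by (auto simp: S_def p_def r_def)
  have min: "p \<bullet> r \<le> p' \<bullet> r'" if "p' \<in> D" "r' \<in> D" "norm p' = 1" "norm r' = 1" for p' r'
    using w[of "(p', r')"] that by (simp add: S_def p_def r_def)
  define d where "d = p \<bullet> r"
  have "c \<le> d"
  proof (cases "d < 1")
    case True
    have nz: "p \<noteq> 0" "r \<noteq> 0" using pr by auto
    have pp: "p \<bullet> p = 1" "r \<bullet> r = 1"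
      using pr by (simp_all add: dot_square_norm)
    \<comment> \<open>Otherwise \<open>r = - p\<close>, and \<open>D\<close> would contain a
      line.\<close>
    have "- 1 < d"
    proof (rule ccontr)
      assume "\<not> - 1 < d"
      then have "(p + r) \<bullet> (p + r) \<le> 0"
        using pp by (simp add: d_def inner_add_left inner_add_right inner_commute)
      then have "r = - p"
        using inner_gt_zero_iff[of "p + r"] by (metis add.inverse_unique linorder_not_less)
      obtain q where q: "q \<in> interior (dual_cone D)"
        using D by (auto simp: body_cone_def)
      have "0 < p \<bullet> q" "0 < r \<bullet> q"
        using dual_cone_interior_pos[OF q] pr nz D dual_cone_dual_cone by (auto simp: body_cone_def)
      then show False
        using \<open>r = - p\<close> by simp
    qed
    define s where "s = sqrt (1 - d\<^sup>2)"
    have s: "s > 0" "s * s = 1 - d\<^sup>2"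
      using True \<open>- 1 < d\<close> abs_square_less_1[of d] by (auto simp: s_def)
    \<comment> \<open>The unit tangent at \<open>r\<close> towards \<open>p\<close>. Extremality
      makes it a normal at \<open>r\<close>, so \<open>r\<close> is a frontier vector and
      \<open>le\<close> applies.\<close>
    define x where "x = (p - d *\<^sub>R r) /\<^sub>R s"
    have "p - d *\<^sub>R r \<in> dual_cone D"
    proof (rule extremal_pair_normal[OF cone _ pr(3,4)])
      fix z assume "z \<in> D"
      have "d * norm p * norm z \<le> p \<bullet> z"
        by (rule cone_unit_inner_bound[OF cone]) (use min d_def pr \<open>z \<in> D\<close> in auto)
      then show "d * norm z \<le> p \<bullet> z" using pr by simp
    qed (simp add: d_def)
    then have x: "x \<in> dual_cone D"
      using s convex_cone_scaleR[OF convex_cone_dual_cone, of "inverse s"] by (simp add: x_def)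
    have xr: "x \<bullet> r = 0"
      using pp by (simp add: x_def inner_diff_left d_def)
    have "x \<bullet> x = (1 - d\<^sup>2) / (s * s)"
      using pp d_def s(1)
      by (simp add: x_def inner_diff_left inner_diff_right inner_commute power2_eq_square field_simps)
    also have "\<dots> = 1"
      unfolding s(2)[symmetric] using s(1) by simp
    finally have nx: "norm x = 1"
      by (simp add: norm_eq_1)
    have "r \<in> frontier D"
      using frontier_convex_cone_normal[of D r] D x pr nx xr by (force simp: body_cone_def)
    moreover have "p = d *\<^sub>R r + s *\<^sub>R x"
      using s by (simp add: x_def)
    ultimately show ?thesis
      using le[of p r x] pr x nx xr True \<open>- 1 < d\<close> by (simp add: d_def s_def)
  qed (use c in auto)
  then show "c \<le> z1 \<bullet> z2"
    using min[of z1 z2] z by (simp add: d_def)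
qed (use z in auto)

lemma const_diam_cone_dual:
  assumes D: "body_cone D" and cd: "const_diam_cone D c" and c: "-1 < c" "c < 1"
  shows "const_diam_cone (dual_cone D) (- c)"
  unfolding const_diam_cone_def
proof (intro conjI ballI impI)
  fix p assume "p \<in> frontier (dual_cone D)" "norm p = 1"
  then show "\<exists>y\<in>dual_cone D. norm y = 1 \<and> p \<bullet> y = - c"
    using dual_const_diam_partner[OF D cd c] by metis
next
  fix z1 z2 assume z: "z1 \<in> dual_cone D" "z2 \<in> dual_cone D"
  show "- c * norm z1 * norm z2 \<le> z1 \<bullet> z2"
  proof (rule body_cone_inner_bound[OF body_cone_dual[OF D] _ _ z])
    fix p x r
    assume p: "p \<in> dual_cone D" "norm p = 1" and r: "r \<in> dual_cone D" "norm r = 1"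
      and "x \<in> dual_cone (dual_cone D)" and x: "norm x = 1" "x \<bullet> r = 0"
      and d: "-1 < p \<bullet> r" "p \<bullet> r < 1"
      and eq: "p = (p \<bullet> r) *\<^sub>R r + sqrt (1 - (p \<bullet> r)\<^sup>2) *\<^sub>R x"
    have xD: "x \<in> D"
      using \<open>x \<in> dual_cone _\<close> D by (simp add: dual_cone_dual_cone body_cone_def)
    define d e s where "d = p \<bullet> r" and "e = sqrt (1 - d\<^sup>2)" and "s = sqrt (1 - c\<^sup>2)"
    have "c *\<^sub>R x + s *\<^sub>R r \<in> D"
      unfolding s_def using const_diam_cone_normal_point[OF D cd c xD x(1) r] x
      by (simp add: inner_commute)
    then have "0 \<le> p \<bullet> (c *\<^sub>R x + s *\<^sub>R r)"
      using p dual_coneD by blast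
    moreover have "p \<bullet> x = e"
      using x by (subst eq) (simp add: inner_add_left inner_commute[of r x] dot_square_norm d_def e_def)
    \<comment> \<open>For \<open>c = cos t\<close> and \<open>d = cos u\<close> with angles in
      \<open>{0<..<pi}\<close> the right side is \<open>sin (t + u)\<close>. Its nonnegativity means
      \<open>t + u \<le> pi\<close>, that is \<open>- c \<le> d\<close>; the case distinction below
      derives this algebraically.\<close>
    ultimately have pos: "0 \<le> c * e + s * d"
      by (simp add: inner_add_right d_def)
    have "s > 0" "e > 0"
      using c d abs_square_less_1[of c] abs_square_less_1[of d]
      by (auto simp: s_def e_def d_def[symmetric])
    show "- c \<le> p \<bullet> r"
    proof (rule ccontr)
      assume "\<not> - c \<le> p \<bullet> r"
      then have dc: "d < - c" by (simp add: d_def)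
      show False
      proof (cases "0 \<le> c")
        case True
        have "c\<^sup>2 \<le> d\<^sup>2"
          using dc True by (intro abs_le_square_iff[THEN iffD1]) auto
        then have "e \<le> s"
          by (simp add: e_def s_def)
        then have "c * e \<le> c * s"
          using True by (rule mult_left_mono)
        also have "\<dots> < (- d) * s"
          using dc \<open>s > 0\<close> by (intro mult_strict_right_mono) auto
        finally show False
          using pos by (simp add: mult.commute)
      next
        case False
        show False
        proof (cases "d \<le> 0")
          case True
          then show False
            using pos False \<open>s > 0\<close> \<open>e > 0\<close> mult_neg_pos[of c e] mult_nonneg_nonpos[of s d] by simp
        next
          case d: False
          then have "d\<^sup>2 \<le> c\<^sup>2"
            using dc False by (intro abs_le_square_iff[THEN iffD1]) auto
          then have "s \<le> e"
            by (simp add: e_def s_def)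
          then have "s * d \<le> e * d"
            using d by (intro mult_right_mono) auto
          also have "\<dots> < e * (- c)"
            using dc \<open>e > 0\<close> by (intro mult_strict_left_mono) auto
          finally show False
            using pos by (simp add: mult.commute)
        qed
      qed
    qed
  qed (use c in auto)
qed

section \<open>Spherical bodies as cones\<close>

text \<open>Radial projection moves \<open>z\<close> by \<open>\<bar>norm z - 1\<bar>\<close>, which
  is at most \<open>norm (z - x)\<close>. This compares balls in space with balls on the
  sphere.\<close>

lemma dist_normalize_le:
  fixes z x :: "'a::real_normed_vector"
  assumes "z \<noteq> 0" "norm x = 1"
  shows "norm (z /\<^sub>R norm z - x) \<le> 2 * norm (z - x)"
proof -
  have "z /\<^sub>R norm z - z = (1 / norm z - 1) *\<^sub>R z"
    by (simp add: algebra_simps divide_inverse)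
  then have "norm (z /\<^sub>R norm z - z) = \<bar>(1 / norm z - 1) * norm z\<bar>"
    by (simp add: abs_mult)
  also have "\<dots> = \<bar>norm z - norm x\<bar>"
    using assms by (simp add: algebra_simps abs_minus_commute)
  also have "\<dots> \<le> norm (z - x)"
    by (rule norm_triangle_ineq3)
  finally show ?thesis
    using norm_triangle_ineq[of "z /\<^sub>R norm z - z" "z - x"] by simp
qed

lemma conic_hull_usphere:
  assumes "K \<subseteq> usphere" "z \<noteq> 0"
  shows "z \<in> conic hull K \<longleftrightarrow> z /\<^sub>R norm z \<in> K"
proof
  assume "z \<in> conic hull K"
  then obtain l u where z: "z = l *\<^sub>R u" "0 \<le> l" "u \<in> K"
    by (auto simp: conic_hull_explicit)
  then have "norm u = 1" "l > 0"
    using assms by (auto simp: usphere_def)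
  then have "z /\<^sub>R norm z = u"
    using z by simp
  then show "z /\<^sub>R norm z \<in> K"
    using z by simp
next
  assume "z /\<^sub>R norm z \<in> K"
  moreover have "z = norm z *\<^sub>R (z /\<^sub>R norm z)"
    using assms by simp
  ultimately show "z \<in> conic hull K"
    unfolding conic_hull_explicit by (metis (mono_tags, lifting) mem_Collect_eq norm_ge_zero)
qed

lemma conic_hull_usphere_unit:
  assumes "K \<subseteq> usphere" "norm z = 1"
  shows "z \<in> conic hull K \<longleftrightarrow> z \<in> K"
  using conic_hull_usphere[OF assms(1), of z] assms(2) by fastforce

lemma dual_cone_conic_hull: "dual_cone (conic hull K) = dual_cone K"
proof
  show "dual_cone (conic hull K) \<subseteq> dual_cone K"
    using hull_subset[of K conic] by (auto simp: dual_cone_def)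
  show "dual_cone K \<subseteq> dual_cone (conic hull K)"
    by (auto simp: dual_cone_def conic_hull_explicit)
qed

lemma subset_hemisphere_iff: "K \<subseteq> usphere \<Longrightarrow> K \<subseteq> hemisphere Q \<longleftrightarrow> Q \<in> dual_cone K"
  by (auto simp: hemisphere_def dual_cone_def)

text \<open>The cone in the definition of spherical convexity omits the origin but contains the
  convex hull of \<open>K\<close>. Its conic hull is that of \<open>K\<close>, which is therefore
  convex.\<close>

lemma sph_convex_positive_cone:
  assumes "sph_convex K"
  shows "convex (conic hull K)" "0 \<notin> convex hull K"
proof -
  define G where "G = {l *\<^sub>R u | l u. l > 0 \<and> u \<in> K}"
  have G: "convex G" and K: "K \<subseteq> usphere"
    using assms by (auto simp: sph_convex_def G_def)
  have "K \<subseteq> G"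
    unfolding G_def by (force intro: exI[of _ 1])
  then have "convex hull K \<subseteq> G"
    using G by (rule hull_minimal)
  moreover have "0 \<notin> G"
    using K by (auto simp: G_def usphere_def)
  ultimately show "0 \<notin> convex hull K"
    by blast
  have eq: "conic hull K = conic hull G"
  proof
    show "conic hull K \<subseteq> conic hull G"
      using \<open>K \<subseteq> G\<close> by (rule hull_mono)
    have "G \<subseteq> conic hull K"
      by (auto simp: G_def conic_hull_explicit intro: less_imp_le)
    then show "conic hull G \<subseteq> conic hull K"
      by (simp add: hull_minimal conic_conic_hull)
  qed
  show "convex (conic hull K)"
    unfolding eq using G by (rule convex_conic_hull)
qed

lemma body_cone_conic_hull:
  assumes "sph_convex_body K"
  shows "body_cone (conic hull K)"
proof -
  have K: "K \<subseteq> usphere" "closed K" "sph_convex K" "sph_interior K \<noteq> {}"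
    using assms by (auto simp: sph_convex_body_def)
  have "usphere = sphere (0::'a) 1"
    by (auto simp: usphere_def)
  then have cK: "compact K"
    using K by (metis compact_Int_closed compact_sphere inf.absorb2)
  have n0: "0 \<notin> K"
    using K by (auto simp: usphere_def)
  obtain x e where x: "x \<in> K" and e: "e > 0" "usphere \<inter> ball x e \<subseteq> K"
    using K(4) by (auto simp: sph_interior_def)
  have nx: "norm x = 1"
    using x K by (auto simp: usphere_def)
  \<comment> \<open>Half of \<open>e\<close> absorbs the factor 2 of radial projection; the bound
    \<open>1\<close> keeps the ball away from the origin.\<close>
  define e' where "e' = min (e / 2) 1"
  have "ball x e' \<subseteq> conic hull K"
  proof
    fix z assume "z \<in> ball x e'"
    then have z: "norm (z - x) < e / 2" "norm (z - x) < 1"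
      by (auto simp: e'_def dist_norm norm_minus_commute)
    then have z0: "z \<noteq> 0"
      using nx by auto
    have "z /\<^sub>R norm z \<in> ball x e"
      using dist_normalize_le[OF z0 nx] z by (simp add: dist_norm norm_minus_commute)
    moreover have "z /\<^sub>R norm z \<in> usphere"
      using z0 by (simp add: usphere_def)
    ultimately show "z \<in> conic hull K"
      using conic_hull_usphere[OF K(1) z0] e by blast
  qed
  moreover have "e' > 0"
    using e by (simp add: e'_def)
  ultimately have "x \<in> interior (conic hull K)"
    by (meson centre_in_ball interior_maximal open_ball subsetD)
  moreover have "convex_cone (conic hull K)"
    using sph_convex_positive_cone[OF K(3)] x
    by (auto simp: convex_cone_def conic_conic_hull conic_hull_eq_empty)
  moreover have "closed (conic hull K)"
    using cK n0 by (simp add: closed_conic_hull)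
  \<comment> \<open>The compact convex hull of \<open>K\<close> misses the origin. Since
    \<open>K\<close> consists of unit vectors, the separation margin \<open>b\<close> is the radius
    of a ball about \<open>a\<close> inside the dual cone.\<close>
  moreover obtain a b where ab: "0 < b" "\<And>x. x \<in> convex hull K \<Longrightarrow> b < a \<bullet> x"
    using separating_hyperplane_closed_0[of "convex hull K"] sph_convex_positive_cone[OF K(3)] cK
    by (auto simp: compact_convex_hull compact_imp_closed)
  have "ball a b \<subseteq> dual_cone K"
  proof
    fix p assume p: "p \<in> ball a b"
    have "0 \<le> p \<bullet> z" if "z \<in> K" for z
    proof -
      have "\<bar>(p - a) \<bullet> z\<bar> \<le> norm (p - a) * norm z"
        by (rule Cauchy_Schwarz_ineq2)
      also have "\<dots> < b"
        using p K that by (auto simp: usphere_def dist_norm norm_minus_commute)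
      finally show ?thesis
        using ab(2)[of z] hull_inc[OF that, of convex] by (auto simp: inner_diff_left)
    qed
    then show "p \<in> dual_cone K"
      by (simp add: dual_cone_def)
  qed
  then have "a \<in> interior (dual_cone K)"
    using ab(1) by (meson centre_in_ball interior_maximal open_ball subsetD)
  ultimately show ?thesis
    by (auto simp: body_cone_def dual_cone_conic_hull)
qed

text \<open>For nonzero vectors, radial projection preserves membership in the cone and moves points
  near \<open>x\<close> only slightly, so outside points near \<open>x\<close> can be taken on the
  sphere.\<close>

lemma sph_boundary_eq_frontier:
  assumes K: "sph_convex_body K" and x: "norm x = 1"
  shows "x \<in> sph_boundary K \<longleftrightarrow> x \<in> frontier (conic hull K)"
proof -
  define D where "D = conic hull K"
  have KS: "K \<subseteq> usphere" and "closed K"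
    using K by (auto simp: sph_convex_body_def)
  have cl: "closed D"
    using body_cone_conic_hull[OF K] by (simp add: body_cone_def D_def)
  show ?thesis unfolding D_def[symmetric]
  proof
    assume b: "x \<in> sph_boundary K"
    then have "x \<in> closure K"
      unfolding closure_approachable sph_boundary_def by (force simp: dist_commute)
    then have "x \<in> K"
      using \<open>closed K\<close> by simp
    then have "x \<in> D"
      by (simp add: D_def hull_inc)
    moreover have "x \<notin> interior D"
    proof
      assume "x \<in> interior D"
      then obtain e where "e > 0" "ball x e \<subseteq> D"
        using mem_interior by blast
      moreover obtain y where "y \<in> ball x e" "y \<in> usphere" "y \<notin> K"
        using b \<open>e > 0\<close> unfolding sph_boundary_def by blast
      ultimately show False
        using conic_hull_usphere_unit[OF KS, of y] by (auto simp: usphere_def D_def)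
    qed
    ultimately show "x \<in> frontier D"
      using cl by (simp add: frontier_def)
  next
    assume f: "x \<in> frontier D"
    then have "x \<in> D" "x \<notin> interior D"
      using cl by (auto simp: frontier_def)
    then have xK: "x \<in> K"
      using conic_hull_usphere_unit[OF KS x] by (simp add: D_def)
    show "x \<in> sph_boundary K"
      unfolding sph_boundary_def
    proof (intro CollectI conjI allI impI)
      show "x \<in> usphere"
        using x by (simp add: usphere_def)
      fix e :: real assume e: "0 < e"
      show "ball x e \<inter> K \<noteq> {}"
        using xK e by force
      have "\<not> ball x (min (e / 2) 1) \<subseteq> D"
        using \<open>x \<notin> interior D\<close> e by (auto simp: mem_interior)
      then obtain z where zb: "z \<in> ball x (min (e / 2) 1)" and "z \<notin> D"
        by blast
      then have z: "norm (z - x) < e / 2" "norm (z - x) < 1" "z \<notin> D"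
        by (auto simp: dist_norm norm_minus_commute)
      then have z0: "z \<noteq> 0"
        using x by auto
      have "z /\<^sub>R norm z \<in> ball x e"
        using dist_normalize_le[OF z0 x] z by (simp add: dist_norm norm_minus_commute)
      moreover have "z /\<^sub>R norm z \<in> usphere - K"
        using z0 z conic_hull_usphere[OF KS z0] by (simp add: usphere_def D_def)
      ultimately show "ball x e \<inter> (usphere - K) \<noteq> {}"
        by blast
    qed
  qed
qed

text \<open>A frontier vector \<open>p\<close> of the dual cone is orthogonal to some nonzero vector
  of the cone. Normalized, this vector has normal \<open>p\<close>, so it is a boundary point where
  the hemisphere touches \<open>K\<close>.\<close>

lemma supporting_hemisphere_iff_frontier:
  assumes K: "sph_convex_body K"
  shows "supporting_hemisphere K p \<longleftrightarrow> norm p = 1 \<and> p \<in> frontier (dual_cone (conic hull K))"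
proof -
  define D where "D = conic hull K"
  have KS: "K \<subseteq> usphere"
    using K by (auto simp: sph_convex_body_def)
  have D: "body_cone D"
    using body_cone_conic_hull[OF K] by (simp add: D_def)
  have dd: "dual_cone (dual_cone D) = D"
    using D by (simp add: body_cone_def dual_cone_dual_cone)
  have fr: "p \<in> frontier (dual_cone D) \<longleftrightarrow> p \<in> dual_cone D \<and> (\<exists>x\<in>D. x \<noteq> 0 \<and> x \<bullet> p = 0)"
    using frontier_convex_cone_normal[of "dual_cone D" p] body_cone_dual[OF D] dd
    by (simp add: body_cone_def)
  have frD: "x \<in> frontier D \<longleftrightarrow> x \<in> D \<and> (\<exists>p\<in>dual_cone D. p \<noteq> 0 \<and> p \<bullet> x = 0)" for x
    using frontier_convex_cone_normal[of D] D by (simp add: body_cone_def)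
  have dK: "K \<subseteq> hemisphere p \<longleftrightarrow> p \<in> dual_cone D"
    using subset_hemisphere_iff[OF KS] by (simp add: D_def dual_cone_conic_hull)
  have bd: "x \<in> sph_boundary K \<longleftrightarrow> norm x = 1 \<and> x \<in> frontier D" for x
    using sph_boundary_eq_frontier[OF K, of x] by (auto simp: D_def sph_boundary_def usphere_def)
  show ?thesis unfolding D_def[symmetric]
  proof
    assume "supporting_hemisphere K p"
    then obtain x where "norm p = 1" "p \<in> dual_cone D" "norm x = 1" "x \<in> D" "p \<bullet> x = 0"
      unfolding supporting_hemisphere_def supporting_hemisphere_at_def dK bd frD
      by (auto simp: usphere_def)
    then show "norm p = 1 \<and> p \<in> frontier (dual_cone D)"
      unfolding fr by (metis inner_commute norm_zero zero_neq_one)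
  next
    assume p: "norm p = 1 \<and> p \<in> frontier (dual_cone D)"
    then obtain x where x: "p \<in> dual_cone D" "x \<in> D" "x \<noteq> 0" "x \<bullet> p = 0"
      unfolding fr by blast
    define u where "u = x /\<^sub>R norm x"
    have u: "u \<in> D" "norm u = 1" "p \<bullet> u = 0"
      using x D by (auto simp: u_def body_cone_def convex_cone_scaleR inner_commute)
    moreover have "p \<noteq> 0" using p by auto
    ultimately have "u \<in> frontier D"
      unfolding frD using x(1) by blast
    then show "supporting_hemisphere K p"
      unfolding supporting_hemisphere_def supporting_hemisphere_at_def dK bd
      using p x u by (auto simp: usphere_def)
  qed
qed

section \<open>Hemispheres, spherical distance and the cone form of both notions\<close>

lemma hemisphere_inject:
  assumes "norm P = 1" "norm Q = 1" "hemisphere P = hemisphere Q"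
  shows "P = Q"
proof (rule ccontr)
  assume "P \<noteq> Q"
  have PP: "P \<bullet> P = 1" "Q \<bullet> Q = 1"
    using assms by (simp_all add: dot_square_norm)
  have "0 < (P - Q) \<bullet> (P - Q)"
    using \<open>P \<noteq> Q\<close> by simp
  then have lt: "P \<bullet> Q < 1"
    using PP by (simp add: inner_diff_left inner_diff_right inner_commute)
  \<comment> \<open>This direction lies in the hemisphere of \<open>P\<close> but not in that of
    \<open>Q\<close>.\<close>
  define z where "z = (P - Q) /\<^sub>R norm (P - Q)"
  have z: "norm z = 1" "P \<bullet> z = (1 - P \<bullet> Q) / norm (P - Q)" "Q \<bullet> z = (P \<bullet> Q - 1) / norm (P - Q)"
    using \<open>P \<noteq> Q\<close> PP by (simp_all add: z_def inner_diff_right inner_commute divide_inverse)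
  have "z \<in> hemisphere P"
    using z lt by (simp add: hemisphere_def usphere_def)
  moreover have "Q \<bullet> z < 0"
    using z(3) lt \<open>P \<noteq> Q\<close> by (simp add: divide_neg_pos)
  ultimately show False
    unfolding assms(3) by (simp add: hemisphere_def)
qed

lemma sdist_le_iff:
  assumes "norm P = 1" "norm Q = 1" "0 \<le> t" "t \<le> pi"
  shows "sdist P Q \<le> t \<longleftrightarrow> cos t \<le> P \<bullet> Q"
proof -
  have "\<bar>P \<bullet> Q\<bar> \<le> 1"
    using Cauchy_Schwarz_ineq2[of P Q] assms by simp
  then have "0 \<le> sdist P Q" "sdist P Q \<le> pi" "cos (sdist P Q) = P \<bullet> Q"
    by (auto simp: sdist_def arccos_lbound arccos_ubound cos_arccos abs_le_iff)
  then show ?thesis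
    using assms cos_mono_le_eq by metis
qed

lemma sdist_eq_iff:
  assumes "norm P = 1" "norm Q = 1" "0 \<le> t" "t \<le> pi"
  shows "sdist P Q = t \<longleftrightarrow> P \<bullet> Q = cos t"
proof -
  have "\<bar>P \<bullet> Q\<bar> \<le> 1"
    using Cauchy_Schwarz_ineq2[of P Q] assms by simp
  then show ?thesis
    using assms by (auto simp: sdist_def cos_arccos_abs arccos_cos)
qed

lemma body_cone_pointed:
  assumes D: "body_cone D" and x: "x \<in> D" "x \<noteq> 0"
  shows "- x \<notin> D"
proof
  assume "- x \<in> D"
  obtain q where q: "q \<in> interior (dual_cone D)"
    using D by (auto simp: body_cone_def)
  have "dual_cone (dual_cone D) = D"
    using D by (simp add: body_cone_def dual_cone_dual_cone)
  then have "0 < x \<bullet> q" "0 < (- x) \<bullet> q"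
    using dual_cone_interior_pos[OF q, of x] dual_cone_interior_pos[OF q, of "- x"] x \<open>- x \<in> D\<close>
    by simp_all
  then show False by simp
qed

text \<open>The sphere is connected in dimension at least two and contains a point of
  \<open>D\<close> whose antipode is outside \<open>D\<close>.\<close>

lemma body_cone_frontier_unit_vector:
  assumes dim: "DIM('a) \<ge> 2" and D: "body_cone (D :: 'a::euclidean_space set)"
  obtains x where "x \<in> frontier D" "norm x = 1"
proof -
  obtain x where x: "x \<in> D" "norm x = 1"
    using body_cone_unit_vector[OF D] .
  then have "- x \<notin> D"
    using body_cone_pointed[OF D, of x] by force
  then have "x \<in> sphere 0 1 \<inter> D" "- x \<in> sphere 0 1 - D"
    using x by auto
  then have "sphere 0 1 \<inter> frontier D \<noteq> {}"
    by (intro connected_Int_frontier connected_sphere dim) blast+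
  then show thesis
    using that by auto
qed

lemma constant_diameter_iff_cone:
  fixes C :: "'a::euclidean_space set"
  assumes dim: "DIM('a) \<ge> 2" and C: "sph_convex_body C" and t: "0 < \<tau>" "\<tau> < pi"
  shows "constant_diameter C \<tau> \<longleftrightarrow> const_diam_cone (conic hull C) (cos \<tau>)"
proof -
  define D where "D = conic hull C"
  have CS: "C \<subseteq> usphere"
    using C by (simp add: sph_convex_body_def)
  have D: "body_cone D"
    using body_cone_conic_hull[OF C] by (simp add: D_def)
  have mem: "x \<in> C \<longleftrightarrow> x \<in> D \<and> norm x = 1" for x
    using conic_hull_usphere_unit[OF CS, of x] CS by (auto simp: usphere_def D_def)
  have bd: "x \<in> sph_boundary C \<longleftrightarrow> norm x = 1 \<and> x \<in> frontier D" for x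
    using sph_boundary_eq_frontier[OF C, of x] by (auto simp: D_def sph_boundary_def usphere_def)
  have bound: "(\<forall>P\<in>C. \<forall>Q\<in>C. sdist P Q \<le> \<tau>) \<longleftrightarrow>
      (\<forall>x\<in>D. \<forall>y\<in>D. cos \<tau> * norm x * norm y \<le> x \<bullet> y)"
  proof
    assume L: "\<forall>P\<in>C. \<forall>Q\<in>C. sdist P Q \<le> \<tau>"
    have "convex_cone D"
      using D by (simp add: body_cone_def)
    moreover have "cos \<tau> \<le> x \<bullet> y" if "x \<in> D" "y \<in> D" "norm x = 1" "norm y = 1" for x y
      using L t mem that sdist_le_iff[of x y \<tau>] by simp
    ultimately show "\<forall>x\<in>D. \<forall>y\<in>D. cos \<tau> * norm x * norm y \<le> x \<bullet> y"
      using cone_unit_inner_bound by blast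
  next
    assume "\<forall>x\<in>D. \<forall>y\<in>D. cos \<tau> * norm x * norm y \<le> x \<bullet> y"
    then have "cos \<tau> \<le> x \<bullet> y" if "x \<in> C" "y \<in> C" for x y
      using that mem by fastforce
    then show "\<forall>P\<in>C. \<forall>Q\<in>C. sdist P Q \<le> \<tau>"
      using t mem by (simp add: sdist_le_iff)
  qed
  have partner: "(\<forall>P\<in>sph_boundary C. \<exists>Q\<in>C. sdist P Q = \<tau>) \<longleftrightarrow>
      (\<forall>x\<in>frontier D. norm x = 1 \<longrightarrow> (\<exists>y\<in>D. norm y = 1 \<and> x \<bullet> y = cos \<tau>))"
    using t mem bd sdist_eq_iff[of _ _ \<tau>] by (metis less_imp_le)
  \<comment> \<open>Some boundary point exists, and its partner shows that the diameter
    \<open>\<tau>\<close> is attained.\<close>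
  obtain x where x: "x \<in> frontier D" "norm x = 1"
    using body_cone_frontier_unit_vector[OF dim D] .
  then have xC: "x \<in> sph_boundary C" "x \<in> C"
    using bd mem D by (auto simp: frontier_def body_cone_def)
  have "\<tau> \<in> {sdist P Q |P Q. P \<in> C \<and> Q \<in> C}"
    if part: "\<forall>P\<in>sph_boundary C. \<exists>Q\<in>C. sdist P Q = \<tau>"
  proof -
    obtain Q where "Q \<in> C" "sdist x Q = \<tau>"
      using part xC(1) by blast
    then have "\<tau> = sdist x Q \<and> x \<in> C \<and> Q \<in> C"
      using xC(2) by simp
    then show ?thesis
      unfolding mem_Collect_eq by blast
  qed
  then show ?thesis
    unfolding constant_diameter_def has_diameter_def const_diam_cone_def D_def[symmetric]
      bound partner[symmetric] by argo
qed

text \<open>A lune has thickness \<open>pi\<close> minus the distance of its centers, so width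
  \<open>\<tau>\<close> at \<open>p\<close> says that the farthest unit vector of the dual cone from
  \<open>p\<close> is at distance \<open>pi - \<tau>\<close>.\<close>

lemma constant_width_iff_cone:
  fixes C :: "'a::euclidean_space set"
  assumes C: "sph_convex_body C" and t: "0 < \<tau>" "\<tau> < pi"
  shows "constant_width C \<tau> \<longleftrightarrow> const_diam_cone (dual_cone (conic hull C)) (- cos \<tau>)"
proof -
  define E where "E = dual_cone (conic hull C)"
  have CS: "C \<subseteq> usphere"
    using C by (simp add: sph_convex_body_def)
  have E: "body_cone E"
    using body_cone_dual body_cone_conic_hull[OF C] by (simp add: E_def)
  have c: "- 1 < cos \<tau>" "cos \<tau> < 1"
    using t cos_monotone_0_pi[of \<tau> pi] cos_monotone_0_pi[of 0 \<tau>] by auto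
  have sup: "supporting_hemisphere C p \<longleftrightarrow> norm p = 1 \<and> p \<in> frontier E" for p
    using supporting_hemisphere_iff_frontier[OF C] by (simp add: E_def)
  have lt: "lune_thicknesses C p = {pi - sdist p q | q. q \<in> E \<and> norm q = 1 \<and> q \<noteq> p}"
    if p: "p \<in> E" "norm p = 1" for p
  proof -
    \<comment> \<open>This rules out opposite hemispheres, so nondegeneracy of the lune reduces to
      \<open>q \<noteq> p\<close>.\<close>
    have "- p \<notin> E"
      using body_cone_pointed[OF E p(1)] p(2) by force
    then have "q \<in> usphere \<and> hemisphere p \<noteq> hemisphere q \<and> hemisphere q \<noteq> hemisphere (- p) \<and> C \<subseteq> hemisphere q
        \<longleftrightarrow> q \<in> E \<and> norm q = 1 \<and> q \<noteq> p" for q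
      using hemisphere_inject[of p q] hemisphere_inject[of q "- p"] p
      by (auto simp: usphere_def subset_hemisphere_iff[OF CS] E_def dual_cone_conic_hull)
    then show ?thesis
      by (simp add: lune_thicknesses_def lune_thickness_def)
  qed
  have width: "has_width C p \<tau> \<longleftrightarrow>
      (\<exists>q\<in>E. norm q = 1 \<and> p \<bullet> q = - cos \<tau>) \<and> (\<forall>q\<in>E. norm q = 1 \<longrightarrow> - cos \<tau> \<le> p \<bullet> q)"
    if p: "p \<in> E" "norm p = 1" for p
  proof -
    have pp: "p \<bullet> p = 1"
      using p by (simp add: dot_square_norm)
    have 1: "\<tau> = pi - sdist p q \<longleftrightarrow> p \<bullet> q = - cos \<tau>" if "norm q = 1" for q
      using sdist_eq_iff[of p q "pi - \<tau>"] p that t by auto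
    have 2: "\<tau> \<le> pi - sdist p q \<longleftrightarrow> - cos \<tau> \<le> p \<bullet> q" if "norm q = 1" for q
      using sdist_le_iff[of p q "pi - \<tau>"] p that t by auto
    have ne: "q \<noteq> p" if "p \<bullet> q = - cos \<tau>" for q
      using that c pp by auto
    have "has_width C p \<tau> \<longleftrightarrow> (\<exists>q\<in>E. norm q = 1 \<and> q \<noteq> p \<and> \<tau> = pi - sdist p q) \<and>
        (\<forall>q\<in>E. norm q = 1 \<longrightarrow> q \<noteq> p \<longrightarrow> \<tau> \<le> pi - sdist p q)"
      unfolding has_width_def lt[OF p] by blast
    also have "\<dots> \<longleftrightarrow> (\<exists>q\<in>E. norm q = 1 \<and> p \<bullet> q = - cos \<tau>) \<and>
        (\<forall>q\<in>E. norm q = 1 \<longrightarrow> q \<noteq> p \<longrightarrow> - cos \<tau> \<le> p \<bullet> q)"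
      using 1 2 ne by metis
    \<comment> \<open>At \<open>q = p\<close> the bound reads \<open>- cos \<tau> \<le> 1\<close>,
      so this case can be restored.\<close>
    also have "\<dots> \<longleftrightarrow> (\<exists>q\<in>E. norm q = 1 \<and> p \<bullet> q = - cos \<tau>) \<and>
        (\<forall>q\<in>E. norm q = 1 \<longrightarrow> - cos \<tau> \<le> p \<bullet> q)"
      using pp c by auto
    finally show ?thesis .
  qed
  have fE: "p \<in> E" if "p \<in> frontier E" for p
    using that E by (auto simp: frontier_def body_cone_def)
  show ?thesis unfolding E_def[symmetric]
  proof
    assume cw: "constant_width C \<tau>"
    have w: "(\<exists>q\<in>E. norm q = 1 \<and> p \<bullet> q = - cos \<tau>) \<and> (\<forall>q\<in>E. norm q = 1 \<longrightarrow> - cos \<tau> \<le> p \<bullet> q)"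
      if "p \<in> frontier E" "norm p = 1" for p
      using cw that width[OF fE] sup by (simp add: constant_width_def)
    show "const_diam_cone E (- cos \<tau>)"
      unfolding const_diam_cone_def
    proof (intro conjI ballI impI)
      fix x y assume xy: "x \<in> E" "y \<in> E"
      show "- cos \<tau> * norm x * norm y \<le> x \<bullet> y"
      \<comment> \<open>Width controls inner products with frontier vectors only; that suffices
        because an extremal pair consists of such vectors.\<close>
      proof (rule body_cone_inner_bound[OF E _ _ xy])
        fix p r assume "p \<in> E" "norm p = 1" "norm r = 1" "r \<in> frontier E"
        then show "- cos \<tau> \<le> p \<bullet> r"
          using w[of r] by (simp add: inner_commute)
      qed (use c in auto)
    qed (use w in blast)
  next
    assume cd: "const_diam_cone E (- cos \<tau>)"
    have "- cos \<tau> \<le> p \<bullet> q" if "p \<in> E" "q \<in> E" "norm p = 1" "norm q = 1" for p q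
      using cd that unfolding const_diam_cone_def by (metis mult.right_neutral)
    then show "constant_width C \<tau>"
      using cd fE unfolding constant_width_def sup const_diam_cone_def by (simp add: width)
  qed
qed

theorem theorem1p1:
  fixes C :: "'a::euclidean_space set" and \<tau> :: real
  assumes "DIM('a) \<ge> 2"
    and "sph_convex_body C"
    and "0 < \<tau>" and "\<tau> < pi"
  shows "constant_diameter C \<tau> \<longleftrightarrow> constant_width C \<tau>"
proof -
  define D where "D = conic hull C"
  have D: "body_cone D"
    using body_cone_conic_hull[OF assms(2)] by (simp add: D_def)
  have c: "- 1 < cos \<tau>" "cos \<tau> < 1"
    using assms cos_monotone_0_pi[of \<tau> pi] cos_monotone_0_pi[of 0 \<tau>] by auto
  have dd: "dual_cone (dual_cone D) = D"
    using D by (simp add: body_cone_def dual_cone_dual_cone)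
  \<comment> \<open>By biduality the converse is the same implication for the dual cone and
    \<open>- cos \<tau>\<close>.\<close>
  have "const_diam_cone D (cos \<tau>) \<longleftrightarrow> const_diam_cone (dual_cone D) (- cos \<tau>)"
    using const_diam_cone_dual[OF D _ c] const_diam_cone_dual[OF body_cone_dual[OF D], of "- cos \<tau>"] c
    by (auto simp: dd)
  then show ?thesis
    using constant_diameter_iff_cone[OF assms] constant_width_iff_cone[OF assms(2-4)]
    by (simp add: D_def)
qed

end
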